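(* For every $k \in \mathbb{N}$ there exists a real number $\lambda_k \ge k^{-2k^2}$ with the following property: for every $k$-complex $\mathcal{S}$ there exists $n_0(\mathcal{S})$ such that for every $n \ge n_0(\mathcal{S})$, every $k$-complex on $n$ vertices with at least $n^{k+1-\lambda_k}$ facets contains a homeomorphic copy of $\mathcal{S}$.
   Context: All simplicial complexes are finite and homogeneous: a $k$-complex (a $k$-dimensional simplicial complex all of whose facets are $k$-dimensional) on a vertex set $V$ is specified by its family of facets, each a $(k+1)$-element subset of $V$; the complex consists of all subsets of its facets. A $k$-complex $\mathcal{T}$ contains a homeomorphic copy (homeomorph) of a $k$-complex $\mathcal{S}$ if some subcomplex of $\mathcal{T}$ is homeomorphic to $\mathcal{S}$ (as topological spaces, via geometric realizations).
   Formalization: Stated for k ≥ 2 only (vertices are taken in ℕ): for k = 1 the claim forces λ_1 ≥ 1 and fails, since the n-cycle has n ≥ n^{2−λ_1} facets but contains no homeomorph of the star K_{1,3}; k = 0 fails likewise with 0^0 = 1. *)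

theory Defs
  imports "HOL-Analysis.Analysis"
begin

definition k_complex :: "nat \<Rightarrow> 'a set \<Rightarrow> 'a set set \<Rightarrow> bool" where
  "k_complex k V F \<longleftrightarrow> finite V \<and> (\<forall>e\<in>F. e \<subseteq> V \<and> card e = k + 1)"

definition faces :: "'a set set \<Rightarrow> 'a set set" where
  "faces F = {s. \<exists>e\<in>F. s \<subseteq> e}"

text \<open>A subcomplex is any subfamily of the faces that is closed under taking subsets; it is
  not required to be homogeneous.\<close>

definition subcomplex :: "'a set set \<Rightarrow> 'a set set \<Rightarrow> bool" where
  "subcomplex L K \<longleftrightarrow> L \<subseteq> K \<and> (\<forall>s\<in>L. \<forall>t. t \<subseteq> s \<longrightarrow> t \<in> L)"

text \<open>Barycentric coordinates: a point is a convex combination of the vertices whose support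
  is a face. Functions carry the product topology, which for complexes with finitely many
  vertices induces the usual Euclidean topology. The empty face contributes no point,
  because the coordinates sum to 1.\<close>

definition realization :: "'a set set \<Rightarrow> ('a \<Rightarrow> real) set" where
  "realization K =
    {x. (\<forall>v. 0 \<le> x v) \<and> {v. x v \<noteq> 0} \<in> K \<and> (\<Sum>v | x v \<noteq> 0. x v) = 1}"

definition contains_homeomorph :: "'a set set \<Rightarrow> 'b set set \<Rightarrow> bool" where
  "contains_homeomorph T S \<longleftrightarrow>
    (\<exists>L. subcomplex L (faces T) \<and> realization L homeomorphic realization (faces S))"

text \<open>In the theorem, complexes live on finite sets of natural numbers; every finite complex
  has such a copy. The dimension \<open>k\<close> starts at 2, because the assertion is false for \<open>k = 1\<close>:
  there \<open>\<lambda> \<ge> 1\<close>, so the \<open>n\<close>-cycle has \<open>n \<ge> n powr (2 - \<lambda>)\<close> facets, but it contains no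
  homeomorph of the star with three edges. (In dimension 1 a constant factor depending on the
  forbidden complex is needed, as in Mader's theorem.) Likewise it is false for \<open>k = 0\<close>, with
  \<open>0\<^sup>0 = 1\<close>.\<close>

end

theory Submission
  imports Defs
begin

text \<open>The homeomorph is found as a copy of the barycentric subdivision of \<open>S\<close>, whose facets are the
  full flags of faces. Its vertices are embedded dimension by dimension, by dependent random choice.
  Write \<open>T\<close> as a set of ordered \<open>r\<close>-tuples, \<open>r = k + 1\<close>, with the image of the largest face of a
  flag first. Pick \<open>t = 2\<^sup>r - 1\<close> random vertices and pass to the \<open>(r - 1)\<close>-tuples that extend by
  each of them to a tuple of \<open>T\<close>. If \<open>T\<close> has density \<open>\<delta>\<close>, this common link has density about
  \<open>\<delta> ^ (t + 1)\<close>. The proper faces of an \<open>r\<close>-set have \<open>n ^ (2\<^sup>r - 2)\<close> placements, and one with boundedly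
  many common extensions survives with probability \<open>O(n ^ (- t))\<close>; as \<open>2\<^sup>r - 2 < t\<close>, some choice
  of the vertices kills all of these. By induction the lower-dimensional faces embed into the common link,
  and then every facet of \<open>S\<close> has so many candidates for its barycentre that distinct unused ones
  can be chosen greedily.\<close>


section \<open>Barycentric subdivision\<close>

lemma subset_chain_subset: "subset.chain A c \<Longrightarrow> d \<subseteq> c \<Longrightarrow> subset.chain A d"
  unfolding subset_chain_def by (meson subset_eq)

text \<open>A nonempty finite chain contains its own union, which is therefore one of the proper
  subsets of \<open>s\<close>. It serves twice: to read off the top weight of a chain, and to extend
  chains to full flags.\<close>

lemma chain_of_proper_subsets_misses_point:
  assumes "finite c" "subset.chain A c" "\<And>f. f \<in> c \<Longrightarrow> f \<subset> s" "s \<noteq> {}"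
  shows "\<exists>v\<in>s. v \<notin> \<Union>c"
proof (cases "c = {}")
  case True
  then show ?thesis using assms by auto
next
  case False
  then have "\<Union>c \<in> c" using Union_in_chain assms by blast
  then show ?thesis using assms(3) by blast
qed

section \<open>Points as nonnegative combinations of chains of faces\<close>

definition chain_point :: "'a set set \<Rightarrow> ('a set \<Rightarrow> real) \<Rightarrow> 'a \<Rightarrow> real" where
  "chain_point F z v = (\<Sum>f\<in>F. z f * indicator f v)"

lemma chain_point_upd:
  assumes "finite F" "s \<in> F"
  shows "chain_point F (z(s := m)) v = chain_point F z v + (m - z s) * indicator s v"
proof -
  have "(\<Sum>f\<in>F - {s}. (z(s := m)) f * indicator f v) = (\<Sum>f\<in>F - {s}. z f * indicator f v)"
    by (intro sum.cong) auto
  then show ?thesis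
    unfolding chain_point_def using assms
    by (simp only: sum.remove[of F s] fun_upd_same) (simp add: algebra_simps)
qed

text \<open>Nonnegative weights cannot cancel.\<close>

lemma chain_point_support:
  assumes "finite F" "\<And>f. 0 \<le> z f" "{f. z f \<noteq> 0} \<subseteq> F"
  shows "{v. chain_point F z v \<noteq> 0} = \<Union>{f. z f \<noteq> 0}"
proof -
  have "chain_point F z v = 0 \<longleftrightarrow> (\<forall>f\<in>F. z f * indicator f v = 0)" for v
    unfolding chain_point_def using assms by (intro sum_nonneg_eq_0_iff) auto
  then show ?thesis using assms(3) by (force simp: indicator_def)
qed

text \<open>Layer by layer decomposition: subtract the least positive value of \<open>x\<close> on
  its whole support. The support shrinks, so the supports met on the way form a chain, and the
  subtracted values are the weights.\<close>

lemma chain_point_surj: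
  assumes "finite F" "\<And>v. 0 \<le> x v" "finite {v. x v \<noteq> 0}" "Pow {v. x v \<noteq> 0} - {{}} \<subseteq> F"
  shows "\<exists>z. (\<forall>f. 0 \<le> z f) \<and> subset.chain (Pow {v. x v \<noteq> 0} - {{}}) {f. z f \<noteq> 0}
           \<and> chain_point F z = x"
  using assms(2-)
proof (induction "card {v. x v \<noteq> 0}" arbitrary: x rule: less_induct)
  case less
  let ?s = "{v. x v \<noteq> 0}"
  show ?case
  proof (cases "?s = {}")
    case True
    then show ?thesis
      by (intro exI[of _ "\<lambda>_. 0"]) (auto simp: subset_chain_def chain_point_def fun_eq_iff)
  next
    case False
    define m where "m = Min (x ` ?s)"
    have m_le: "m \<le> x v" if "x v \<noteq> 0" for v
      unfolding m_def using less.prems that by (intro Min_le) auto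
    have "m \<in> x ` ?s" unfolding m_def using False less.prems by (intro Min_in) auto
    then obtain w where w: "x w = m" "x w \<noteq> 0" by auto
    then have m_pos: "m > 0" using less.prems(1)[of w] by linarith
    define x' where "x' = (\<lambda>v. x v - m * indicator ?s v)"
    have x'_nonneg: "0 \<le> x' v" for v
      using m_le[of v] less.prems(1)[of v] by (auto simp: x'_def indicator_def)
    have supp: "{v. x' v \<noteq> 0} \<subset> ?s"
      using w by (auto simp: x'_def indicator_def split: if_splits)
    have "\<exists>z. (\<forall>f. 0 \<le> z f) \<and> subset.chain (Pow {v. x' v \<noteq> 0} - {{}}) {f. z f \<noteq> 0}
           \<and> chain_point F z = x'"
    proof (rule less.hyps)
      show "card {v. x' v \<noteq> 0} < card ?s" by (rule psubset_card_mono[OF less.prems(2) supp])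
      show "finite {v. x' v \<noteq> 0}" using supp less.prems(2) by (meson finite_subset psubset_imp_subset)
      show "Pow {v. x' v \<noteq> 0} - {{}} \<subseteq> F"
        using Pow_mono[OF psubset_imp_subset[OF supp]] less.prems(3) by blast
    qed (rule x'_nonneg)
    then obtain z where z: "\<forall>f. 0 \<le> z f" "subset.chain (Pow {v. x' v \<noteq> 0} - {{}}) {f. z f \<noteq> 0}"
      "chain_point F z = x'" by blast
    \<comment> \<open>All sets weighted so far lie in the strictly smaller support of
      \<open>x'\<close>, so \<open>?s\<close> still has weight 0 and fits on top of the
      chain.\<close>
    have sF: "?s \<in> F" using False less.prems(3) by auto
    have zs: "z ?s = 0" using z(2) supp by (auto simp: subset_chain_def)
    have upd: "{f. (z(?s := m)) f \<noteq> 0} = insert ?s {f. z f \<noteq> 0}" using m_pos by auto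
    have sub: "f \<subseteq> ?s \<and> f \<noteq> {}" if "z f \<noteq> 0" for f
    proof -
      have "f \<in> Pow {v. x' v \<noteq> 0} - {{}}" using z(2) that unfolding subset_chain_def by blast
      then show ?thesis using supp by blast
    qed
    have cmp: "f \<subseteq> g \<or> g \<subseteq> f" if "z f \<noteq> 0" "z g \<noteq> 0" for f g
      using z(2) that unfolding subset_chain_def by blast
    have "subset.chain (Pow ?s - {{}}) (insert ?s {f. z f \<noteq> 0})"
      unfolding subset_chain_def using cmp sub False by blast
    then have "subset.chain (Pow ?s - {{}}) {f. (z(?s := m)) f \<noteq> 0}" by (simp only: upd)
    moreover have "chain_point F (z(?s := m)) = x"
      using z(3) zs by (auto simp: chain_point_upd[OF assms(1) sF] x'_def fun_eq_iff)
    moreover have "\<forall>f. 0 \<le> (z(?s := m)) f" using z(1) m_pos by simp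
    ultimately show ?thesis by blast
  qed
qed

text \<open>On the largest set \<open>s\<close> of the chain every coordinate is at least
  \<open>z s\<close>, with equality at a point of \<open>s\<close> that lies in no smaller member.
  Hence the top weight is a minimum that depends on the point alone.\<close>

lemma chain_point_top:
  assumes "finite F" "{} \<notin> F" "\<And>f. 0 \<le> z f" "subset.chain F {f. z f \<noteq> 0}" "z s \<noteq> 0"
    and s: "s = \<Union>{f. z f \<noteq> 0}"
  shows "\<And>v. v \<in> s \<Longrightarrow> z s \<le> chain_point F z v" "\<exists>v\<in>s. chain_point F z v = z s"
proof -
  have sub: "{f. z f \<noteq> 0} \<subseteq> F" using assms(4) by (simp add: subset_chain_def)
  have sF: "s \<in> F" using sub assms(5) by auto
  have split: "chain_point F z v = z s * indicator s v + (\<Sum>f\<in>F - {s}. z f * indicator f v)" for v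
    unfolding chain_point_def using assms(1) sF by (rule sum.remove)
  show "z s \<le> chain_point F z v" if "v \<in> s" for v
    using that assms(3) unfolding split by (simp add: sum_nonneg)
  have "\<exists>v\<in>s. v \<notin> \<Union>({f. z f \<noteq> 0} - {s})"
  proof (rule chain_of_proper_subsets_misses_point)
    show "finite ({f. z f \<noteq> 0} - {s})" using sub assms(1) finite_subset by blast
    show "subset.chain F ({f. z f \<noteq> 0} - {s})" using assms(4) by (auto simp: subset_chain_def)
    show "s \<noteq> {}" using sF assms(2) by auto
  qed (use s in auto)
  then obtain v where v: "v \<in> s" "\<And>f. z f \<noteq> 0 \<Longrightarrow> f \<noteq> s \<Longrightarrow> v \<notin> f" by blast
  have "(\<Sum>f\<in>F - {s}. z f * indicator f v) = 0"
    using v(2) by (intro sum.neutral) (auto simp: indicator_def)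
  then show "\<exists>v\<in>s. chain_point F z v = z s" using v(1) unfolding split by auto
qed

text \<open>The point determines the top set, which is its support, and the top weight, by
  \<open>chain_point_top\<close>. Removing that set from both chains leaves a smaller
  instance.\<close>

lemma chain_point_inj:
  assumes "finite F" "{} \<notin> F"
    and "\<And>f. 0 \<le> z f" "subset.chain F {f. z f \<noteq> 0}"
    and "\<And>f. 0 \<le> z' f" "subset.chain F {f. z' f \<noteq> 0}"
    and "chain_point F z = chain_point F z'"
  shows "z = z'"
  using assms(3-)
proof (induction "card {f. z f \<noteq> 0}" arbitrary: z z' rule: less_induct)
  case less
  have sub: "{f. z f \<noteq> 0} \<subseteq> F" "{f. z' f \<noteq> 0} \<subseteq> F"
    using less.prems by (auto simp: subset_chain_def)
  have fin: "finite {f. z f \<noteq> 0}" "finite {f. z' f \<noteq> 0}"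
    using sub assms(1) finite_subset by blast+
  have un: "\<Union>{f. z f \<noteq> 0} = \<Union>{f. z' f \<noteq> 0}"
    using chain_point_support[OF assms(1) less.prems(1) sub(1)]
      chain_point_support[OF assms(1) less.prems(3) sub(2)] less.prems(5) by simp
  show ?case
  proof (cases "{f. z f \<noteq> 0} = {}")
    case True
    then have "f = {}" if "z' f \<noteq> 0" for f using un that by auto
    then have "z' f = 0" for f using sub(2) assms(2) by auto
    then show ?thesis using True by auto
  next
    case False
    define s where "s = \<Union>{f. z f \<noteq> 0}"
    have s': "s = \<Union>{f. z' f \<noteq> 0}" using un s_def by simp
    have zs: "z s \<noteq> 0" using Union_in_chain[OF fin(1) False less.prems(2)] s_def by auto
    have sF: "s \<in> F" using sub(1) zs by auto
    have "{f. z' f \<noteq> 0} \<noteq> {}"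
    proof
      assume "{f. z' f \<noteq> 0} = {}"
      then have "s = {}" using s' by simp
      then show False using sF assms(2) by simp
    qed
    then have zs': "z' s \<noteq> 0" using Union_in_chain[OF fin(2) _ less.prems(4)] s' by auto
    note t = chain_point_top[OF assms(1,2) less.prems(1,2) zs s_def]
    note t' = chain_point_top[OF assms(1,2) less.prems(3,4) zs' s']
    have eq: "z s = z' s"
      using t t' less.prems(5) by (metis order_antisym)
    have "z(s := 0) = z'(s := 0)"
    proof (rule less.hyps)
      have "{f. (z(s := 0)) f \<noteq> 0} = {f. z f \<noteq> 0} - {s}" by auto
      then show "card {f. (z(s := 0)) f \<noteq> 0} < card {f. z f \<noteq> 0}"
        using fin(1) zs by (metis card_Diff1_less mem_Collect_eq)
      show "chain_point F (z(s := 0)) = chain_point F (z'(s := 0))"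
        using less.prems(5) eq by (simp add: fun_eq_iff chain_point_upd[OF assms(1) sF])
    qed (use less.prems(1-4) in \<open>auto simp: subset_chain_def\<close>)
    then show ?thesis using eq by (metis fun_upd_triv fun_upd_upd)
  qed
qed

section \<open>The subdivision is homeomorphic to the complex\<close>

lemma compact_realization:
  fixes K :: "'a set set"
  assumes "finite K" "\<And>s. s \<in> K \<Longrightarrow> finite s" "\<And>s t. s \<in> K \<Longrightarrow> t \<subseteq> s \<Longrightarrow> t \<in> K"
  shows "compact (realization K)"
proof -
  \<comment> \<open>Closed simplices: the support only has to lie inside \<open>s\<close>, since
    prescribing it exactly would not give a closed set. Each is a compact box cut by a
    hyperplane.\<close>
  define P where "P s = {x::'a \<Rightarrow> real. (\<forall>v. x v \<in> (if v \<in> s then {0..1} else {0})) \<and> sum x s = 1}" for s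
  have "realization K = (\<Union>s\<in>K. P s)"
  proof (intro subset_antisym subsetI)
    fix x assume x: "x \<in> realization K"
    let ?s = "{v. x v \<noteq> 0}"
    have s: "?s \<in> K" "sum x ?s = 1" "\<forall>v. 0 \<le> x v" using x by (auto simp: realization_def)
    have "x v \<le> 1" if "x v \<noteq> 0" for v
      using member_le_sum[of v ?s x] s assms(2)[of ?s] that by auto
    then have "x \<in> P ?s" using s by (auto simp: P_def)
    then show "x \<in> (\<Union>s\<in>K. P s)" using s by blast
  next
    fix x assume "x \<in> (\<Union>s\<in>K. P s)"
    then obtain s where s: "s \<in> K" "x \<in> P s" by blast
    have sub: "{v. x v \<noteq> 0} \<subseteq> s" "\<forall>v. 0 \<le> x v"
      using s(2) by (auto simp: P_def split: if_splits)
    have "sum x s = sum x {v. x v \<noteq> 0}"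
      using assms(2)[OF s(1)] sub by (intro sum.mono_neutral_right) auto
    then show "x \<in> realization K"
      using s sub assms(3)[OF s(1)] by (auto simp: realization_def P_def)
  qed
  moreover have "compact (P s)" if "s \<in> K" for s
  proof -
    let ?Q = "PiE UNIV (\<lambda>v. if v \<in> s then {0..1} else {0::real})"
    have "compactin (product_topology (\<lambda>_. euclidean) UNIV) ?Q"
      unfolding compactin_PiE by auto
    then have "compact ?Q" by (simp add: euclidean_product_topology)
    moreover have "closed {x::'a \<Rightarrow> real. sum x s = 1}"
      by (intro closed_Collect_eq continuous_on_sum continuous_on_product_coordinates continuous_on_const)
    moreover have "P s = ?Q \<inter> {x. sum x s = 1}"
      by (auto simp: P_def PiE_def Pi_def)
    ultimately show ?thesis by (metis compact_Int_closed)
  qed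
  ultimately show ?thesis using assms(1) by auto
qed

text \<open>The map \<open>h\<close> sends the vertex \<open>\<phi> f\<close> to the barycentre of
  \<open>f\<close> and is linear in the coordinates. Unique decomposition along chains makes it
  bijective.\<close>

lemma realization_subdivision_homeomorphic:
  fixes \<phi> :: "'a::countable set \<Rightarrow> 'b"
  assumes K: "finite K" "\<And>s. s \<in> K \<Longrightarrow> finite s" "\<And>s t. s \<in> K \<Longrightarrow> t \<subseteq> s \<Longrightarrow> t \<in> K"
    and inj: "inj_on \<phi> (K - {{}})"
  shows "realization {\<phi> ` c |c. subset.chain (K - {{}}) c} homeomorphic realization K"
proof -
  define F where "F = K - {{}}"
  define L where "L = {\<phi> ` c |c. subset.chain F c}"
  have F: "finite F" "{} \<notin> F" "\<And>f. f \<in> F \<Longrightarrow> finite f \<and> card f > 0"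
    using K by (auto simp: F_def card_gt_0_iff)
  have injF: "inj_on \<phi> F" using inj F_def by simp
  \<comment> \<open>The barycentre of \<open>f\<close> is its indicator divided by
    \<open>card f\<close>; the division turns barycentric weights into the indicator weights of
    \<open>chain_point\<close>.\<close>
  define w where "w y f = (if f \<in> F then y (\<phi> f) / card f else 0)" for y :: "'b \<Rightarrow> real" and f
  define h where "h y = chain_point F (w y)" for y
  have L: "finite L" "\<And>s. s \<in> L \<Longrightarrow> finite s" "\<And>s t. s \<in> L \<Longrightarrow> t \<subseteq> s \<Longrightarrow> t \<in> L"
  proof -
    have "L \<subseteq> (`) \<phi> ` Pow F" by (auto simp: L_def subset_chain_def)
    then show "finite L" using F(1) by (meson finite_Pow_iff finite_imageI finite_subset)
    show "finite s" if "s \<in> L" for s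
      using that F(1) finite_subset by (auto simp: L_def subset_chain_def)
    fix s t assume "s \<in> L" "t \<subseteq> s"
    then obtain c where c: "s = \<phi> ` c" "subset.chain F c" by (auto simp: L_def)
    then obtain d where d: "d \<subseteq> c" "t = \<phi> ` d" using \<open>t \<subseteq> s\<close> by (auto simp: subset_image_iff)
    have "subset.chain F d" using c(2) d(1) by (rule subset_chain_subset)
    then show "t \<in> L" using d(2) unfolding L_def by blast
  qed
  have w_props: "(\<forall>f. 0 \<le> w y f) \<and> subset.chain F {f. w y f \<noteq> 0} \<and>
      {u. y u \<noteq> 0} = \<phi> ` {f. w y f \<noteq> 0}" if y: "y \<in> realization L" for y
  proof -
    obtain c where c: "{u. y u \<noteq> 0} = \<phi> ` c" "subset.chain F c"
      using y by (auto simp: realization_def L_def)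
    have cF: "c \<subseteq> F" using c(2) by (simp add: subset_chain_def)
    have "{f. w y f \<noteq> 0} = {f\<in>F. \<phi> f \<in> \<phi> ` c}"
      using F(2,3) unfolding c(1)[symmetric] by (auto simp: w_def)
    also have "\<dots> = c" using cF injF by (auto simp: inj_on_def)
    finally show ?thesis using c y by (auto simp: w_def realization_def)
  qed
  have outside: "y u = 0" if y: "y \<in> realization L" and u: "u \<notin> \<phi> ` F" for y u
  proof (rule ccontr)
    assume "y u \<noteq> 0"
    moreover have "{u. y u \<noteq> 0} = \<phi> ` {f. w y f \<noteq> 0}" using w_props[OF y] by (elim conjE)
    ultimately obtain f where "u = \<phi> f" "w y f \<noteq> 0" by blast
    then show False using u by (auto simp: w_def split: if_splits)
  qed
  \<comment> \<open>Each indicator divided by its cardinality has coordinate sum 1, so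
    \<open>h\<close> preserves the total mass. This is used for both inclusions of the
    image.\<close>
  have total: "sum (chain_point F (w y)) {v. chain_point F (w y) v \<noteq> 0} = (\<Sum>u | y u \<noteq> 0. y u)"
    if y: "\<forall>f. 0 \<le> w y f" "subset.chain F {f. w y f \<noteq> 0}" "{u. y u \<noteq> 0} = \<phi> ` {f. w y f \<noteq> 0}" for y
  proof -
    have sub: "{f. w y f \<noteq> 0} \<subseteq> F" using y(2) by (simp add: subset_chain_def)
    have "sum (chain_point F (w y)) {v. chain_point F (w y) v \<noteq> 0} = sum (chain_point F (w y)) (\<Union>F)"
      using F(1,3) chain_point_support[OF F(1) _ sub] y(1) sub by (intro sum.mono_neutral_left) auto
    also have "\<dots> = (\<Sum>f\<in>F. \<Sum>v\<in>\<Union>F. w y f * indicator f v)"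
      unfolding chain_point_def by (rule sum.swap)
    also have "\<dots> = (\<Sum>f\<in>F. y (\<phi> f))"
    proof (rule sum.cong)
      fix f assume f: "f \<in> F"
      have "(\<Sum>v\<in>\<Union>F. w y f * indicator f v) = (\<Sum>v\<in>f. w y f)"
        using F(1,3) f by (intro sum.mono_neutral_cong_right) auto
      then show "(\<Sum>v\<in>\<Union>F. w y f * indicator f v) = y (\<phi> f)"
        using f F(2) F(3)[OF f] by (auto simp: w_def)
    qed simp
    also have "\<dots> = (\<Sum>f | w y f \<noteq> 0. y (\<phi> f))"
      using F sub by (intro sum.mono_neutral_right) (auto simp: w_def)
    also have "\<dots> = (\<Sum>u | y u \<noteq> 0. y u)"
      using injF sub unfolding y(3) by (subst sum.reindex) (auto simp: inj_on_subset)
    finally show ?thesis .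
  qed
  have "realization L homeomorphic realization K"
  \<comment> \<open>Compactness of the source makes a continuous bijection a homeomorphism, so
    continuity of the inverse need not be checked.\<close>
  proof (rule homeomorphic_compact)
    show "compact (realization L)" using L by (rule compact_realization)
    have "continuous_on UNIV h"
    proof (rule continuous_on_coordinatewise_then_product)
      fix v
      show "continuous_on UNIV (\<lambda>y. h y v)"
        unfolding h_def chain_point_def
      proof (intro continuous_on_sum continuous_on_mult continuous_on_const)
        fix f assume "f \<in> F"
        then show "continuous_on UNIV (\<lambda>y. w y f)"
          using F(3)[of f] unfolding w_def
          by (auto intro!: continuous_intros continuous_on_product_coordinates)
      qed
    qed
    then show "continuous_on (realization L) h" using continuous_on_subset by blast
    show "inj_on h (realization L)"
    proof (rule inj_onI)
      fix y y' assume y: "y \<in> realization L" and y': "y' \<in> realization L" and "h y = h y'"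
      then have weq: "w y = w y'"
        unfolding h_def using w_props[OF y] w_props[OF y'] F by (intro chain_point_inj[of F]) auto
      show "y = y'"
      proof
        fix u
        show "y u = y' u"
        proof (cases "u \<in> \<phi> ` F")
          case True
          then obtain f where f: "f \<in> F" "u = \<phi> f" by blast
          then show ?thesis using fun_cong[OF weq, of f] F(3)[of f] by (auto simp: w_def)
        next
          case False
          then show ?thesis using outside[OF y] outside[OF y'] by simp
        qed
      qed
    qed
    show "h ` realization L = realization K"
    proof (intro subset_antisym subsetI)
      fix x assume "x \<in> h ` realization L"
      then obtain y where y: "y \<in> realization L" "x = h y" by blast
      note p = w_props[OF y(1)]
      let ?c = "{f. w y f \<noteq> 0}"
      have sub: "?c \<subseteq> F" using p by (simp add: subset_chain_def)
      have supp: "{v. x v \<noteq> 0} = \<Union>?c"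
        unfolding y(2) h_def using p sub by (intro chain_point_support F(1)) auto
      have "?c \<noteq> {}" using p y(1) by (auto simp: realization_def)
      then have "\<Union>?c \<in> ?c"
        using p by (intro Union_in_chain[OF finite_subset[OF sub F(1)]]) auto
      then have "\<Union>?c \<in> K" using sub F_def by blast
      moreover have "(\<Sum>v | x v \<noteq> 0. x v) = 1"
        using total[of y] p y by (auto simp: h_def realization_def)
      moreover have "\<forall>v. 0 \<le> x v"
        using p unfolding y(2) h_def chain_point_def by (auto intro!: sum_nonneg)
      ultimately show "x \<in> realization K" unfolding realization_def using supp by auto
    next
      fix x assume x: "x \<in> realization K"
      let ?s = "{v. x v \<noteq> 0}"
      have s: "?s \<in> K" "\<forall>v. 0 \<le> x v" "sum x ?s = 1" using x by (auto simp: realization_def)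
      have PF: "Pow ?s - {{}} \<subseteq> F" using K(3)[OF s(1)] F_def by auto
      obtain z where z: "\<forall>f. 0 \<le> z f" "subset.chain (Pow ?s - {{}}) {f. z f \<noteq> 0}"
        "chain_point F z = x"
        using chain_point_surj[of F x] F(1) s K(2)[OF s(1)] PF by blast
      have ch: "subset.chain F {f. z f \<noteq> 0}" using z(2) PF by (auto simp: subset_chain_def)
      \<comment> \<open>The preimage multiplies by \<open>card f\<close> to undo the normalisation
        in \<open>w\<close>.\<close>
      define y where "y u = (if u \<in> \<phi> ` F then card (the_inv_into F \<phi> u) * z (the_inv_into F \<phi> u) else 0)" for u
      have y_phi: "y (\<phi> f) = card f * z f" if "f \<in> F" for f
        using that by (simp add: y_def the_inv_into_f_f[OF injF])
      have wz: "w y = z"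
      proof
        fix f show "w y f = z f"
          using y_phi[of f] F(3)[of f] ch by (auto simp: w_def subset_chain_def)
      qed
      have supp: "{u. y u \<noteq> 0} = \<phi> ` {f. z f \<noteq> 0}"
      proof (intro subset_antisym subsetI)
        fix u assume "u \<in> {u. y u \<noteq> 0}"
        then have "u \<in> \<phi> ` F" "y u \<noteq> 0" by (auto simp: y_def split: if_splits)
        then show "u \<in> \<phi> ` {f. z f \<noteq> 0}" using y_phi by fastforce
      next
        fix u assume "u \<in> \<phi> ` {f. z f \<noteq> 0}"
        then obtain f where f: "u = \<phi> f" "z f \<noteq> 0" by blast
        then have "f \<in> F" using ch by (auto simp: subset_chain_def)
        then show "u \<in> {u. y u \<noteq> 0}" using f y_phi[of f] F(3)[of f] by auto
      qed
      have "{u. y u \<noteq> 0} \<in> L" unfolding supp L_def using ch by blast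
      moreover have "(\<Sum>u | y u \<noteq> 0. y u) = 1"
        using total[of y] z ch supp s(3) unfolding wz by simp
      moreover have "\<forall>u. 0 \<le> y u" using z(1) by (simp add: y_def)
      ultimately have "y \<in> realization L" by (simp add: realization_def)
      moreover have "h y = x" using z(3) wz by (simp add: h_def)
      ultimately show "x \<in> h ` realization L" by blast
    qed
  qed
  then show ?thesis by (simp add: L_def F_def)
qed

section \<open>Embedding flags into dense families of tuples\<close>

definition tuples :: "nat \<Rightarrow> 'a set \<Rightarrow> 'a list set" where
  "tuples t A = {xs. set xs \<subseteq> A \<and> length xs = t}"

lemma finite_tuples: "finite A \<Longrightarrow> finite (tuples t A)"
  unfolding tuples_def by (rule finite_lists_length_eq)

lemma card_tuples: "finite A \<Longrightarrow> card (tuples t A) = card A ^ t"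
  unfolding tuples_def by (rule card_lists_length_eq)

text \<open>The sets have sizes \<open>r\<close> down to 1. Putting the largest first means that the
  tail is a full flag of the head, which matches the induction on \<open>r\<close>.\<close>

primrec flag :: "nat \<Rightarrow> 'a set \<Rightarrow> 'a set list \<Rightarrow> bool" where
  "flag 0 A xs \<longleftrightarrow> xs = []"
| "flag (Suc r) A xs \<longleftrightarrow> (\<exists>f ys. xs = f # ys \<and> f \<subseteq> A \<and> card f = Suc r \<and> flag r f ys)"

lemma flag_mono: "flag r A xs \<Longrightarrow> A \<subseteq> B \<Longrightarrow> flag r B xs"
  by (cases r) auto

lemma flag_member:
  "flag r A xs \<Longrightarrow> g \<in> set xs \<Longrightarrow> g \<subseteq> A \<and> 0 < card g \<and> card g \<le> r"
proof (induction r arbitrary: A xs)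
  case (Suc r)
  then obtain f ys where f: "xs = f # ys" "f \<subseteq> A" "card f = Suc r" "flag r f ys" by auto
  show ?case
  proof (cases "g = f")
    case False
    then have "g \<in> set ys" using Suc.prems f by simp
    from Suc.IH[OF f(4) this] show ?thesis using f(2) by auto
  qed (use f in auto)
qed simp

text \<open>All nonempty subsets of \<open>V\<close> of size at most \<open>r\<close> are placed,
  not just the faces of a given complex. Thus a complex enters the embedding argument only through
  its vertex set.\<close>

definition flag_embedding :: "nat \<Rightarrow> 'a set \<Rightarrow> 'b set \<Rightarrow> 'b list set \<Rightarrow> ('a set \<Rightarrow> 'b) \<Rightarrow> bool" where
  "flag_embedding r V W G \<phi> \<longleftrightarrow>
     inj_on \<phi> {f. f \<subseteq> V \<and> f \<noteq> {} \<and> card f \<le> r} \<and>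
     \<phi> ` {f. f \<subseteq> V \<and> f \<noteq> {} \<and> card f \<le> r} \<subseteq> W \<and>
     (\<forall>xs. flag r V xs \<longrightarrow> map \<phi> xs \<in> G)"

text \<open>Greedy choice: each chosen point moves from the demand \<open>card I\<close> to the
  forbidden set \<open>B\<close>, so the required bound is preserved.\<close>

lemma distinct_representatives_avoiding:
  assumes "finite I" "finite B" "\<And>i. i \<in> I \<Longrightarrow> card I + card B \<le> card (A i)"
  shows "\<exists>g. inj_on g I \<and> (\<forall>i\<in>I. g i \<in> A i - B)"
  using assms
proof (induction I arbitrary: B rule: finite_induct)
  case (insert i I)
  have "card B < card (A i)" using insert by force
  then obtain a where a: "a \<in> A i" "a \<notin> B"
    by (metis card_mono insert.prems(1) not_le subsetI)
  have "\<exists>g. inj_on g I \<and> (\<forall>j\<in>I. g j \<in> A j - insert a B)"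
    using insert.prems insert.hyps a by (intro insert.IH) auto
  then obtain g where g: "inj_on g I" "\<forall>j\<in>I. g j \<in> A j - insert a B" by blast
  have "inj_on (g(i := a)) (insert i I)"
    using g insert.hyps by (auto simp: inj_on_def)
  moreover have "\<forall>j\<in>insert i I. (g(i := a)) j \<in> A j - B" using g a by auto
  ultimately show ?case by blast
qed auto

section \<open>Dependent random choice by double counting\<close>

lemma sum_card_swap:
  assumes "finite X" "finite E"
  shows "(\<Sum>x\<in>X. card {e\<in>E. R x e}) = (\<Sum>e\<in>E. card {x\<in>X. R x e})"
proof -
  have "(\<Sum>x\<in>X. card {e\<in>E. R x e}) = (\<Sum>x\<in>X. \<Sum>e\<in>E. if R x e then 1 else 0)"
    using assms by (simp add: sum.If_cases Int_def)
  also have "\<dots> = (\<Sum>e\<in>E. \<Sum>x\<in>X. if R x e then 1 else 0)" by (rule sum.swap)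
  also have "\<dots> = (\<Sum>e\<in>E. card {x\<in>X. R x e})"
    using assms by (simp add: sum.If_cases Int_def)
  finally show ?thesis .
qed

text \<open>Call a tail \<open>e\<close> heavy if at least \<open>d * n\<close> vertices extend it,
  with \<open>n = card W\<close>. Light tails account for at most half of the assumed lower bound on
  \<open>card G\<close>, so at least \<open>d * n ^ r\<close> tails are heavy. Each heavy tail lies
  in the common link of at least \<open>(d * n) ^ t\<close> tuples. This replaces a convexity
  argument.\<close>

lemma sum_link_sizes_ge:
  fixes G :: "'b list set" and d :: real
  assumes W: "finite W" "W \<noteq> {}" and G: "G \<subseteq> tuples (Suc r) W"
    and d: "0 \<le> d" "2 * d * real (card W) ^ Suc r \<le> card G"
  shows "d ^ Suc t * real (card W) ^ (r + t)
         \<le> (\<Sum>xs\<in>tuples t W. real (card {e\<in>tuples r W. \<forall>w\<in>set xs. w # e \<in> G}))"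
proof -
  let ?n = "real (card W)"
  define N where "N e = {w\<in>W. w # e \<in> G}" for e
  define H where "H = {e\<in>tuples r W. d * ?n \<le> card (N e)}"
  have finN: "finite (N e)" "card (N e) \<le> card W" for e
    using W by (auto simp: N_def intro: card_mono)
  have finr: "finite (tuples r W)" using W finite_tuples by blast
  have finH: "finite H" "H \<subseteq> tuples r W" using finr by (auto simp: H_def)
  have "G = (\<lambda>(e, w). w # e) ` Sigma (tuples r W) N"
  proof (intro subset_antisym subsetI)
    fix xs assume xs: "xs \<in> G"
    then obtain w e where "xs = w # e" using G by (cases xs) (auto simp: tuples_def)
    moreover then have "w \<in> W" "e \<in> tuples r W" using xs subsetD[OF G, of xs] by (auto simp: tuples_def)
    ultimately show "xs \<in> (\<lambda>(e, w). w # e) ` Sigma (tuples r W) N"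
      using xs by (force simp: N_def)
  qed (auto simp: N_def)
  then have "card G = (\<Sum>e\<in>tuples r W. card (N e))"
    using finr finN by (simp add: card_image inj_on_def card_SigmaI)
  then have "real (card G) = (\<Sum>e\<in>tuples r W. real (card (N e)))" by simp
  also have "\<dots> = (\<Sum>e\<in>tuples r W - H. real (card (N e))) + (\<Sum>e\<in>H. real (card (N e)))"
    using finH finr by (simp add: sum.subset_diff)
  also have "\<dots> \<le> (\<Sum>e\<in>tuples r W - H. d * ?n) + (\<Sum>e\<in>H. ?n)"
    using finN by (intro add_mono sum_mono) (auto simp: H_def)
  also have "\<dots> \<le> ?n ^ r * (d * ?n) + card H * ?n"
  proof -
    have "real (card (tuples r W - H)) \<le> ?n ^ r"
      using card_mono[of "tuples r W" "tuples r W - H"] finr card_tuples[OF W(1), of r]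
      by (metis Diff_subset of_nat_le_iff of_nat_power)
    then show ?thesis using d by (simp add: mult_right_mono)
  qed
  finally have le: "d * ?n ^ r * ?n \<le> card H * ?n" using d(2) by (simp add: algebra_simps)
  have "?n > 0" using W by (simp add: card_gt_0_iff)
  then have H_ge: "d * ?n ^ r * ?n ^ t \<le> card H * ?n ^ t"
    using le by (intro mult_right_mono) auto
  have "d ^ Suc t * ?n ^ (r + t) = d ^ t * (d * ?n ^ r * ?n ^ t)"
    by (simp add: power_add algebra_simps)
  also have "\<dots> \<le> d ^ t * (card H * ?n ^ t)" using H_ge d by (intro mult_left_mono) auto
  also have "\<dots> = (\<Sum>e\<in>H. (d * ?n) ^ t)" by (simp add: power_mult_distrib algebra_simps)
  also have "\<dots> \<le> (\<Sum>e\<in>H. real (card (N e)) ^ t)"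
    using d by (intro sum_mono power_mono) (auto simp: H_def)
  also have "\<dots> \<le> (\<Sum>e\<in>tuples r W. real (card (N e)) ^ t)"
    using finH finr by (intro sum_mono2) auto
  \<comment> \<open>The tuples whose entries all extend \<open>e\<close> are exactly the
    \<open>t\<close>-tuples over \<open>N e\<close>.\<close>
  also have "\<dots> = real (\<Sum>e\<in>tuples r W. card {xs\<in>tuples t W. \<forall>w\<in>set xs. w # e \<in> G})"
  proof -
    have "{xs\<in>tuples t W. \<forall>w\<in>set xs. w # e \<in> G} = tuples t (N e)" for e
      by (auto simp: tuples_def N_def)
    then show ?thesis using finN by (simp add: card_tuples)
  qed
  also have "\<dots> = real (\<Sum>xs\<in>tuples t W. card {e\<in>tuples r W. \<forall>w\<in>set xs. w # e \<in> G})"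
    using sum_card_swap[of "tuples t W" "tuples r W" "\<lambda>xs e. \<forall>w\<in>set xs. w # e \<in> G"]
      finite_tuples[OF W(1)] by simp
  finally show ?thesis by simp
qed

text \<open>First moment method: average the link size minus \<open>n ^ r\<close> times the number
  of bad events. A tuple of at least average value has a large link, and it meets no bad event
  because the penalty for one already outweighs every possible link.\<close>

lemma dependent_random_choice:
  fixes G :: "'b list set" and d q :: real
  assumes W: "finite W" "W \<noteq> {}" and G: "G \<subseteq> tuples (Suc r) W"
    and d: "0 \<le> d" "2 * d * real (card W) ^ Suc r \<le> card G"
    and B: "finite B" "\<And>b. b \<in> B \<Longrightarrow> D b \<subseteq> W \<and> card (D b) \<le> M"
    and q: "0 < q" "q * real (card W) ^ t
      \<le> d ^ Suc t * real (card W) ^ (r + t) - real (card W) ^ r * (card B * real M ^ t)"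
  shows "\<exists>xs\<in>tuples t W. q \<le> card {e\<in>tuples r W. \<forall>w\<in>set xs. w # e \<in> G}
           \<and> (\<forall>b\<in>B. \<not> set xs \<subseteq> D b)"
proof -
  let ?n = "real (card W)"
  define link where "link xs = real (card {e\<in>tuples r W. \<forall>w\<in>set xs. w # e \<in> G})" for xs
  define bad where "bad xs = card {b\<in>B. set xs \<subseteq> D b}" for xs
  have fin: "finite (tuples m W)" for m using W finite_tuples by blast
  have "(\<Sum>xs\<in>tuples t W. bad xs) = (\<Sum>b\<in>B. card {xs\<in>tuples t W. set xs \<subseteq> D b})"
    unfolding bad_def by (rule sum_card_swap[OF fin B(1)])
  \<comment> \<open>A tuple contained in \<open>D b\<close> has at most \<open>M\<close> choices for
    each entry.\<close>
  also have "\<dots> \<le> (\<Sum>b\<in>B. M ^ t)"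
  proof (rule sum_mono)
    fix b assume b: "b \<in> B"
    have "{xs\<in>tuples t W. set xs \<subseteq> D b} \<subseteq> tuples t (D b)" by (auto simp: tuples_def)
    moreover have "finite (D b)" using B(2)[OF b] W finite_subset by blast
    ultimately have "card {xs\<in>tuples t W. set xs \<subseteq> D b} \<le> card (D b) ^ t"
      by (metis card_mono card_tuples finite_tuples)
    also have "\<dots> \<le> M ^ t" using B(2)[OF b] by (simp add: power_mono)
    finally show "card {xs\<in>tuples t W. set xs \<subseteq> D b} \<le> M ^ t" .
  qed
  finally have "(\<Sum>xs\<in>tuples t W. bad xs) \<le> card B * M ^ t" by simp
  then have bad_le: "(\<Sum>xs\<in>tuples t W. real (bad xs)) \<le> card B * real M ^ t"
    by (metis of_nat_le_iff of_nat_mult of_nat_power of_nat_sum)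
  have "(\<Sum>xs\<in>tuples t W. q) \<le> d ^ Suc t * ?n ^ (r + t) - ?n ^ r * (card B * real M ^ t)"
    using q(2) W by (simp add: card_tuples mult.commute)
  also have "\<dots> \<le> (\<Sum>xs\<in>tuples t W. link xs) - ?n ^ r * (\<Sum>xs\<in>tuples t W. real (bad xs))"
    unfolding link_def
    by (intro diff_mono sum_link_sizes_ge[OF W G d] mult_left_mono[OF bad_le]) auto
  also have "\<dots> = (\<Sum>xs\<in>tuples t W. link xs - ?n ^ r * real (bad xs))"
    by (simp add: sum_subtractf sum_distrib_left)
  finally have sum_le: "(\<Sum>xs\<in>tuples t W. q) \<le> (\<Sum>xs\<in>tuples t W. link xs - ?n ^ r * real (bad xs))" .
  have "card (tuples t W) \<noteq> 0" using W by (simp add: card_tuples)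
  then have "tuples t W \<noteq> {}" by auto
  then obtain xs where xs: "xs \<in> tuples t W" "q \<le> link xs - ?n ^ r * real (bad xs)"
    using sum_le sum_strict_mono[OF fin, of t "\<lambda>xs. link xs - ?n ^ r * real (bad xs)" "\<lambda>_. q"]
    by (meson not_le)
  have "link xs \<le> ?n ^ r"
  proof -
    have "card {e\<in>tuples r W. \<forall>w\<in>set xs. w # e \<in> G} \<le> card (tuples r W)"
      using fin by (intro card_mono) auto
    then have "link xs \<le> real (card (tuples r W))" unfolding link_def by (rule of_nat_mono)
    then show ?thesis using W(1) by (simp add: card_tuples)
  qed
  have "bad xs = 0"
  proof (rule ccontr)
    assume "bad xs \<noteq> 0"
    then have "?n ^ r * 1 \<le> ?n ^ r * real (bad xs)" by (intro mult_left_mono) auto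
    then show False using xs(2) \<open>link xs \<le> ?n ^ r\<close> q(1) by linarith
  qed
  then have "\<forall>b\<in>B. \<not> set xs \<subseteq> D b" using B(1) by (auto simp: bad_def)
  moreover have "q \<le> link xs" using xs(2) \<open>bad xs = 0\<close> by simp
  ultimately show ?thesis using xs(1) unfolding link_def by blast
qed

section \<open>Exponents and the induction on the flag length\<close>

lemma eventually_powr_dominates:
  fixes a c C e :: real
  assumes "a < e" "a < 1" "0 < c"
  shows "eventually (\<lambda>n::nat. C / n + n powr (- e) \<le> c * n powr (- a)) sequentially"
proof -
  \<comment> \<open>After division by \<open>n powr (- a)\<close> both terms on the left tend to
    0.\<close>
  have "((\<lambda>n::nat. C * n powr (a - 1) + n powr (a - e)) \<longlongrightarrow> C * 0 + 0) sequentially"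
    using assms by (intro tendsto_intros tendsto_neg_powr filterlim_real_sequentially) auto
  then have "eventually (\<lambda>n::nat. C * n powr (a - 1) + n powr (a - e) < c) sequentially"
    using assms(3) by (intro order_tendstoD(2)) auto
  then show ?thesis
    using eventually_gt_at_top[of 0]
  proof eventually_elim
    case (elim n)
    have "real n powr (a - 1) * n powr (- a) = n powr (- 1)" "n powr (a - e) * n powr (- a) = n powr (- e)"
      by (simp_all only: powr_add[symmetric]) simp_all
    moreover have "real n powr (- 1) = 1 / n" using elim(2) by (simp add: powr_minus_divide)
    ultimately have "C / n + n powr (- e) = (C * n powr (a - 1) + n powr (a - e)) * n powr (- a)"
      by (simp only: distrib_right mult.assoc) simp
    also have "\<dots> \<le> c * n powr (- a)" using elim(1) by (intro mult_right_mono) auto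
    finally show ?case .
  qed
qed

text \<open>Passing to a common link raises the density to the power \<open>2 ^ i\<close>. The extra
  1 in each factor gives the slack that absorbs constants and bad events.\<close>

definition flag_exponent :: "nat \<Rightarrow> real" where
  "flag_exponent r = (\<Prod>i=1..r. 1 / (2 ^ i + 1))"

lemma flag_exponent_pos: "0 < flag_exponent r"
  unfolding flag_exponent_def by (intro prod_pos) (auto simp: add_pos_pos)

lemma flag_exponent_le_1: "flag_exponent r \<le> 1"
  unfolding flag_exponent_def by (intro prod_le_1) (auto simp: divide_le_eq_1 add_pos_pos)

lemma flag_exponent_Suc: "flag_exponent (Suc r) * (2 ^ Suc r + 1) = flag_exponent r"
proof -
  have "(2::real) ^ Suc r + 1 \<noteq> 0" by (smt (verit) zero_less_power)
  then show ?thesis unfolding flag_exponent_def by (simp add: prod.nat_ivl_Suc')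
qed

text \<open>A flag contains only one set of size \<open>Suc r\<close>, so the new images constrain
  each other only by being distinct. At most \<open>2 ^ card V\<close> sets need images and at most
  \<open>2 ^ card V\<close> vertices are taken, whence the threshold.\<close>

lemma flag_embedding_extend:
  fixes \<phi> :: "'a set \<Rightarrow> 'b"
  assumes V: "finite V" and W: "finite W"
    and \<phi>: "flag_embedding r V W G' \<phi>"
    and many: "\<And>f. f \<subseteq> V \<Longrightarrow> card f = Suc r \<Longrightarrow>
      2 ^ Suc (card V) \<le> card {w\<in>W. \<forall>xs. flag r f xs \<longrightarrow> w # map \<phi> xs \<in> G}"
  shows "\<exists>\<phi>'. flag_embedding (Suc r) V W G \<phi>'"
proof -
  define I where "I = {f. f \<subseteq> V \<and> card f = Suc r}"
  define J where "J = {f. f \<subseteq> V \<and> f \<noteq> {} \<and> card f \<le> r}"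
  define A where "A f = {w\<in>W. \<forall>xs. flag r f xs \<longrightarrow> w # map \<phi> xs \<in> G}" for f
  have sub: "I \<subseteq> Pow V" "J \<subseteq> Pow V" by (auto simp: I_def J_def)
  have fin: "finite I" "finite J" using sub V by (auto intro: finite_subset[of _ "Pow V"])
  have "card I \<le> 2 ^ card V" "card J \<le> 2 ^ card V"
    using card_mono[OF _ sub(1)] card_mono[OF _ sub(2)] V by (auto simp: card_Pow)
  moreover have "card (\<phi> ` J) \<le> card J" using fin(2) by (rule card_image_le)
  ultimately have "card I + card (\<phi> ` J) \<le> 2 ^ Suc (card V)" by simp
  then have "\<exists>g. inj_on g I \<and> (\<forall>f\<in>I. g f \<in> A f - \<phi> ` J)"
    using fin many by (intro distinct_representatives_avoiding) (auto simp: I_def A_def intro: order_trans)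
  then obtain g where g: "inj_on g I" "\<forall>f\<in>I. g f \<in> A f - \<phi> ` J" by blast
  define \<phi>' where "\<phi>' f = (if f \<in> I then g f else \<phi> f)" for f
  have IJ: "{f. f \<subseteq> V \<and> f \<noteq> {} \<and> card f \<le> Suc r} = I \<union> J" "I \<inter> J = {}"
    by (auto simp: I_def J_def)
  have J\<phi>: "inj_on \<phi> J" "\<phi> ` J \<subseteq> W"
    using \<phi> by (auto simp: flag_embedding_def J_def)
  have eqI: "\<phi>' f = g f" if "f \<in> I" for f using that by (simp add: \<phi>'_def)
  have eqJ: "\<phi>' f = \<phi> f" if "f \<in> J" for f using that IJ(2) by (auto simp: \<phi>'_def)
  have "inj_on \<phi>' I" using g(1) eqI by (simp cong: inj_on_cong)
  moreover have "inj_on \<phi>' J" using J\<phi>(1) eqJ by (simp cong: inj_on_cong)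
  moreover have "\<phi>' ` I \<inter> \<phi>' ` J = {}"
  proof -
    have "\<phi>' ` I = g ` I" "\<phi>' ` J = \<phi> ` J" using eqI eqJ by (auto intro!: image_cong)
    then show ?thesis using g(2) by auto
  qed
  ultimately have "inj_on \<phi>' (I \<union> J)" by (auto simp: inj_on_Un)
  moreover have "\<phi>' ` (I \<union> J) \<subseteq> W"
    using eqI eqJ g(2) J\<phi>(2) by (auto simp: A_def)
  moreover have "map \<phi>' xs \<in> G" if xs: "flag (Suc r) V xs" for xs
  proof -
    obtain f ys where f: "xs = f # ys" "f \<subseteq> V" "card f = Suc r" "flag r f ys" using xs by auto
    have fI: "f \<in> I" using f by (simp add: I_def)
    have "h \<in> J" if "h \<in> set ys" for h
      using flag_member[OF f(4) that] f(2) by (auto simp: J_def)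
    then have "map \<phi>' xs = g f # map \<phi> ys" using eqJ eqI[OF fI] f(1) by simp
    moreover have "g f # map \<phi> ys \<in> G" using g(2) fI f(4) by (auto simp: A_def)
    ultimately show ?thesis by (simp only:)
  qed
  ultimately show ?thesis by (auto simp: flag_embedding_def IJ(1))
qed

text \<open>The threshold for \<open>n\<close> is uniform in \<open>W\<close> and \<open>G\<close>,
  because the induction hypothesis is applied to a link that depends on \<open>G\<close>.\<close>

theorem dense_tuples_contain_flag_embedding:
  fixes V :: "'a set"
  assumes V: "finite V"
  shows "eventually (\<lambda>n. \<forall>(W::'b set) G. finite W \<longrightarrow> card W = n \<longrightarrow> G \<subseteq> tuples r W \<longrightarrow>
    real n powr (real r - flag_exponent r) \<le> card G \<longrightarrow> (\<exists>\<phi>. flag_embedding r V W G \<phi>)) sequentially"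
proof (induction r)
  case 0
  show ?case
    using eventually_gt_at_top[of 0]
  proof eventually_elim
    case (elim n)
    show ?case
    proof (intro allI impI)
      fix W :: "'b set" and G
      assume G: "G \<subseteq> tuples 0 W" "real n powr (real 0 - flag_exponent 0) \<le> card G"
      \<comment> \<open>In length 0 the density assumption says only that \<open>G\<close> is
        nonempty.\<close>
      have "0 < real n powr (real 0 - flag_exponent 0)" using elim by simp
      then have "G \<noteq> {}" using G(2) by auto
      then have "[] \<in> G" using G(1) by (auto simp: tuples_def)
      moreover have empty: "{f. f \<subseteq> V \<and> f \<noteq> {} \<and> card f \<le> 0} = {}"
        using V finite_subset by fastforce
      ultimately show "\<exists>\<phi>. flag_embedding 0 V W G \<phi>"
        unfolding flag_embedding_def empty by simp
    qed
  qed
next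
  case (Suc r)
  \<comment> \<open>A set of size \<open>Suc r\<close> has \<open>t - 1\<close> proper nonempty
    subsets, one fewer than the number of sampled vertices. This saves the factor
    \<open>1 / n\<close> in the expected number of bad patterns, which is at most
    \<open>C / n\<close>.\<close>
  define t where "t = (2::nat) ^ Suc r - 1"
  define M where "M = (2::nat) ^ Suc (card V)"
  define C where "C = (2::real) ^ card V * real M ^ t"
  \<comment> \<open>The link has density of order \<open>n powr (- a)\<close>, and \<open>a\<close>
    equals \<open>flag_exponent r - flag_exponent (Suc r)\<close>.\<close>
  define a where "a = flag_exponent (Suc r) * 2 ^ Suc r"
  have t: "Suc t = 2 ^ Suc r" by (simp add: t_def)
  have a: "a < flag_exponent r"
    using flag_exponent_Suc[of r] flag_exponent_pos[of "Suc r"] by (simp add: a_def algebra_simps)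
  then have "a < 1" using flag_exponent_le_1[of r] by linarith
  then have "eventually (\<lambda>n::nat. C / n + n powr (- flag_exponent r) \<le> (1/2) ^ Suc t * n powr (- a)) sequentially"
    using a by (intro eventually_powr_dominates) auto
  then show ?case
    using Suc.IH eventually_gt_at_top[of 0]
  proof eventually_elim
    case (elim n)
    show ?case
    proof (intro allI impI)
      fix W :: "'b set" and G
      assume W: "finite W" "card W = n" and G: "G \<subseteq> tuples (Suc r) W"
        and Gbig: "real n powr (real (Suc r) - flag_exponent (Suc r)) \<le> card G"
      have n: "0 < real n" using elim(3) by simp
      have W0: "W \<noteq> {}" using W elim(3) by auto
      define d where "d = real n powr (- flag_exponent (Suc r)) / 2"
      define I where "I = {f. f \<subseteq> V \<and> card f = Suc r}"
      define D where "D p = {w\<in>W. \<forall>xs. flag r (fst p) xs \<longrightarrow> w # map (snd p) xs \<in> G}"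
        for p :: "'a set \<times> ('a set \<Rightarrow> 'b)"
      \<comment> \<open>A pattern is a set \<open>f\<close> with arbitrary images of its proper
        nonempty subsets. These alone determine the candidates \<open>D\<close> for the image of
        \<open>f\<close>, and each \<open>f\<close> has only \<open>n ^ (t - 1)\<close>
        patterns.\<close>
      define S where "S = Sigma I (\<lambda>f. (Pow f - {{}, f}) \<rightarrow>\<^sub>E W)"
      define B where "B = {p\<in>S. card (D p) \<le> M}"
      have finI: "finite I" "card I \<le> 2 ^ card V"
      proof -
        have "I \<subseteq> Pow V" by (auto simp: I_def)
        then show "finite I" "card I \<le> 2 ^ card V"
          using V by (auto simp: card_Pow[symmetric] intro: finite_subset card_mono)
      qed
      have finf: "finite f" "card (Pow f - {{}, f}) = t - 1" if "f \<in> I" for f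
      proof -
        show f: "finite f" using that V finite_subset by (auto simp: I_def)
        have "f \<noteq> {}" using that by (auto simp: I_def)
        then show "card (Pow f - {{}, f}) = t - 1"
          using f that by (subst card_Diff_subset) (auto simp: card_Pow I_def t_def)
      qed
      have cardS: "finite S" "card S \<le> 2 ^ card V * n ^ (t - 1)"
      proof -
        show "finite S" unfolding S_def using finI finf W by (intro finite_SigmaI finite_PiE) auto
        have "card S = (\<Sum>f\<in>I. n ^ (t - 1))"
          unfolding S_def using finI finf W
          by (subst card_SigmaI) (auto simp: finite_PiE card_funcsetE)
        then show "card S \<le> 2 ^ card V * n ^ (t - 1)" using finI by simp
      qed
      have finB: "finite B" using cardS(1) by (simp add: B_def)
      have "card B \<le> card S" using cardS(1) by (intro card_mono) (auto simp: B_def)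
      then have cardB: "real (card B) \<le> 2 ^ card V * real n ^ (t - 1)"
        using cardS(2) by (metis (mono_tags, lifting) of_nat_le_iff of_nat_mult of_nat_numeral of_nat_power order_trans)
      have dG: "2 * d * real (card W) ^ Suc r \<le> card G"
      proof -
        have "2 * d * real n ^ Suc r = real n powr (- flag_exponent (Suc r)) * real n powr real (Suc r)"
          unfolding d_def using n by (simp only: powr_realpow)
        also have "\<dots> = real n powr (real (Suc r) - flag_exponent (Suc r))"
          by (simp add: powr_add[symmetric])
        finally show ?thesis using Gbig W(2) by simp
      qed
      define q where "q = real n powr (real r - flag_exponent r)"
      have q: "q = real n ^ r * real n powr (- flag_exponent r)"
        unfolding q_def using n by (simp add: powr_realpow[symmetric] powr_add[symmetric])
      have "(1::nat) \<le> 2 ^ r" by simp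
      then have t_pos: "t = Suc (t - 1)" unfolding t_def power_Suc by linarith
      \<comment> \<open>Divided by \<open>n ^ (r + t)\<close>, this compares the density needed for
        the induction hypothesis plus the bad patterns with the average link density
        \<open>d ^ Suc t\<close>.\<close>
      have "q * real n ^ t \<le> d ^ Suc t * real n ^ (r + t) - real n ^ r * (card B * real M ^ t)"
      proof -
        have dpow: "d ^ Suc t = (1/2) ^ Suc t * real n powr (- a)"
          unfolding d_def a_def t using n
          by (simp add: power_divide powr_power mult.commute)
        have "real n ^ r * (card B * real M ^ t) \<le> real n ^ r * ((2 ^ card V * real n ^ (t - 1)) * real M ^ t)"
          using cardB by (intro mult_left_mono mult_right_mono) auto
        also have "\<dots> = real n ^ (r + t) * (C / n)"
          using n by (subst (3) t_pos) (simp add: C_def power_add)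
        finally have "q * real n ^ t + real n ^ r * (card B * real M ^ t)
            \<le> real n ^ (r + t) * (C / n + real n powr (- flag_exponent r))"
          by (simp add: q power_add algebra_simps)
        also have "\<dots> \<le> real n ^ (r + t) * d ^ Suc t"
          unfolding dpow using elim(1) by (intro mult_left_mono) auto
        finally show ?thesis by (simp add: algebra_simps)
      qed
      then obtain xs where xs: "xs \<in> tuples t W"
          "q \<le> card {e\<in>tuples r W. \<forall>w\<in>set xs. w # e \<in> G}" "\<forall>b\<in>B. \<not> set xs \<subseteq> D b"
        using dependent_random_choice[OF W(1) W0 G _ dG finB, of D M q t] W n
        by (auto simp: d_def q_def B_def D_def)
      define G' where "G' = {e\<in>tuples r W. \<forall>w\<in>set xs. w # e \<in> G}"
      have "G' \<subseteq> tuples r W" by (auto simp: G'_def)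
      then obtain \<phi> where \<phi>: "flag_embedding r V W G' \<phi>"
        using elim(2) W xs(2) unfolding q_def G'_def by blast
      show "\<exists>\<phi>. flag_embedding (Suc r) V W G \<phi>"
      proof (rule flag_embedding_extend[OF V W(1) \<phi>])
        fix f assume f: "f \<subseteq> V" "card f = Suc r"
        define \<psi> where "\<psi> = restrict \<phi> (Pow f - {{}, f})"
        \<comment> \<open>A flag of length \<open>r\<close> inside the larger set \<open>f\<close>
          consists of proper nonempty subsets, so the restriction loses nothing.\<close>
        have map_eq: "map \<psi> ys = map \<phi> ys" if "flag r f ys" for ys
          using flag_member[OF that] f(2) by (force simp: \<psi>_def)
        have Deq: "D (f, \<psi>) = {w\<in>W. \<forall>xs. flag r f xs \<longrightarrow> w # map \<phi> xs \<in> G}"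
          unfolding D_def by (simp add: map_eq del: map_eq_conv cong: imp_cong)
        \<comment> \<open>The embedding maps flags into the common link, so every sampled vertex is
          a candidate for \<open>f\<close>. No bad pattern has all sampled vertices as candidates,
          hence this one has more than \<open>M\<close>.\<close>
        have "set xs \<subseteq> D (f, \<psi>)"
        proof
          fix w assume w: "w \<in> set xs"
          have "w # map \<phi> ys \<in> G" if "flag r f ys" for ys
          proof -
            have "map \<phi> ys \<in> G'"
              using \<phi> flag_mono[OF that f(1)] by (simp add: flag_embedding_def)
            then show ?thesis using w by (simp add: G'_def)
          qed
          then show "w \<in> D (f, \<psi>)" using w xs(1) by (auto simp: Deq tuples_def)
        qed
        moreover have "(f, \<psi>) \<in> S"
        proof -
          have "\<phi> g \<in> W" if "g \<in> Pow f - {{}, f}" for g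
          proof -
            have "card g < card f"
              using that f V finite_subset[OF f(1) V] by (intro psubset_card_mono) auto
            then have "g \<in> {f. f \<subseteq> V \<and> f \<noteq> {} \<and> card f \<le> r}" using that f by auto
            then show ?thesis using \<phi> unfolding flag_embedding_def by blast
          qed
          then show ?thesis using f by (auto simp: S_def I_def \<psi>_def)
        qed
        ultimately have "\<not> card (D (f, \<psi>)) \<le> M" using xs(3) by (auto simp: B_def)
        then show "2 ^ Suc (card V) \<le> card {w\<in>W. \<forall>xs. flag r f xs \<longrightarrow> w # map \<phi> xs \<in> G}"
          unfolding Deq M_def by simp
      qed
    qed
  qed
qed

section \<open>Homeomorphs in dense complexes\<close>

text \<open>Put \<open>e\<close> on top. The other members of the chain miss a common point
  \<open>v\<close>, so they form a chain in \<open>e - {v}\<close> and induction applies.\<close>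

lemma chain_extends_to_flag:
  assumes "finite e" "card e = r" "subset.chain (Pow e - {{}}) c"
  shows "\<exists>xs. flag r e xs \<and> c \<subseteq> set xs"
  using assms
proof (induction r arbitrary: e c)
  case 0
  then show ?case by (auto simp: subset_chain_def)
next
  case (Suc r)
  have sub: "c \<subseteq> Pow e - {{}}" using Suc.prems(3) by (simp add: subset_chain_def)
  have "\<exists>v\<in>e. v \<notin> \<Union>(c - {e})"
  proof (rule chain_of_proper_subsets_misses_point)
    show "finite (c - {e})"
      using sub Suc.prems(1) by (meson Diff_subset finite_Diff finite_Pow_iff finite_subset)
    show "subset.chain (Pow e - {{}}) (c - {e})"
      using Suc.prems(3) by (rule subset_chain_subset) auto
    show "e \<noteq> {}" using Suc.prems(2) by auto
  qed (use sub in auto)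
  then obtain v where v: "v \<in> e" "\<And>f. f \<in> c \<Longrightarrow> f \<noteq> e \<Longrightarrow> v \<notin> f" by blast
  have "subset.chain (Pow (e - {v}) - {{}}) (c - {e})"
    using Suc.prems(3) v sub unfolding subset_chain_def by blast
  then have "\<exists>ys. flag r (e - {v}) ys \<and> c - {e} \<subseteq> set ys"
    using Suc.prems v(1) by (intro Suc.IH) auto
  then obtain ys where ys: "flag r (e - {v}) ys" "c - {e} \<subseteq> set ys" by blast
  have "flag (Suc r) e (e # ys)" using flag_mono[OF ys(1)] Suc.prems(2) by auto
  moreover have "c \<subseteq> set (e # ys)" using ys(2) by auto
  ultimately show ?case by blast
qed

text \<open>The images of chains of nonempty faces form the subdivision of \<open>S\<close>. Such a
  chain lies in a facet and extends to a full flag of it, whose image is a facet of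
  \<open>T\<close>.\<close>

lemma flag_embedding_imp_contains_homeomorph:
  fixes \<phi> :: "'a::countable set \<Rightarrow> 'b"
  assumes S: "k_complex k V S" and T: "T \<noteq> {}"
    and \<phi>: "flag_embedding (Suc k) V W {xs. set xs \<in> T} \<phi>"
  shows "contains_homeomorph T S"
proof -
  define K where "K = faces S"
  define L where "L = {\<phi> ` c |c. subset.chain (K - {{}}) c}"
  have V: "finite V" and S': "\<And>e. e \<in> S \<Longrightarrow> e \<subseteq> V \<and> card e = Suc k"
    using S by (auto simp: k_complex_def)
  have KV: "f \<subseteq> V \<and> card f \<le> Suc k" if "f \<in> K" for f
  proof -
    obtain e where e: "e \<in> S" "f \<subseteq> e" using \<open>f \<in> K\<close> by (auto simp: K_def faces_def)
    then have "card f \<le> card e" using S'[OF e(1)] V by (meson card_mono finite_subset)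
    then show ?thesis using S'[OF e(1)] e(2) by auto
  qed
  have "inj_on \<phi> (K - {{}})"
    using \<phi> KV unfolding flag_embedding_def by (auto elim!: inj_on_subset)
  moreover have "finite K" using KV V by (auto intro: finite_subset[of K "Pow V"])
  moreover have "\<And>s. s \<in> K \<Longrightarrow> finite s" using KV V finite_subset by blast
  moreover have "\<And>s t. s \<in> K \<Longrightarrow> t \<subseteq> s \<Longrightarrow> t \<in> K" by (auto simp: K_def faces_def)
  ultimately have "realization L homeomorphic realization K"
    unfolding L_def by (intro realization_subdivision_homeomorphic) auto
  moreover have "subcomplex L (faces T)"
    unfolding subcomplex_def
  proof (intro conjI ballI allI impI subsetI)
    fix s assume "s \<in> L"
    then obtain c where c: "s = \<phi> ` c" "subset.chain (K - {{}}) c" by (auto simp: L_def)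
    show "s \<in> faces T"
    proof (cases "c = {}")
      \<comment> \<open>The empty chain gives the empty face, which belongs to
        \<open>faces T\<close> as soon as \<open>T\<close> has a facet.\<close>
      case True
      then show ?thesis using T c(1) by (auto simp: faces_def)
    next
      case False
      have cK: "c \<subseteq> K - {{}}" using c(2) by (simp add: subset_chain_def)
      have "finite c" using cK \<open>finite K\<close> by (meson finite_Diff finite_subset)
      then have "\<Union>c \<in> K" using Union_in_chain[OF _ False c(2)] cK by blast
      then obtain e where e: "e \<in> S" "\<Union>c \<subseteq> e" by (auto simp: K_def faces_def)
      have "subset.chain (Pow e - {{}}) c"
        using c(2) e(2) unfolding subset_chain_def by blast
      then obtain xs where xs: "flag (Suc k) e xs" "c \<subseteq> set xs"
        using chain_extends_to_flag[of e "Suc k" c] S'[OF e(1)] V finite_subset by blast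
      have "flag (Suc k) V xs" using flag_mono[OF xs(1)] S'[OF e(1)] by blast
      then have "set (map \<phi> xs) \<in> T" using \<phi> unfolding flag_embedding_def by blast
      moreover have "s \<subseteq> set (map \<phi> xs)" using xs(2) c(1) by auto
      ultimately show ?thesis by (auto simp: faces_def)
    qed
  next
    fix s t assume "s \<in> L" "t \<subseteq> s"
    then obtain c where c: "s = \<phi> ` c" "subset.chain (K - {{}}) c" by (auto simp: L_def)
    then obtain d where d: "d \<subseteq> c" "t = \<phi> ` d" using \<open>t \<subseteq> s\<close> by (auto simp: subset_image_iff)
    then show "t \<in> L" using subset_chain_subset[OF c(2) d(1)] unfolding L_def by blast
  qed
  ultimately show ?thesis unfolding contains_homeomorph_def K_def by blast
qed

section \<open>Numerical bound on the exponent\<close>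

lemma prod_pow2_le:
  assumes "2 \<le> k"
  shows "(\<Prod>i=1..Suc k. 2 ^ i + 1 :: nat) \<le> k ^ (2 * k\<^sup>2)"
  using assms
proof (induction k rule: nat_induct_at_least)
  case base
  \<comment> \<open>Here 3 * 5 * 9 = 135 is at most 2 ^ 8 = 256.\<close>
  show ?case by (simp add: numeral_eq_Suc)
next
  case (Suc k)
  have "(\<Prod>i=1..Suc (Suc k). 2 ^ i + 1 :: nat) = (2 ^ Suc (Suc k) + 1) * (\<Prod>i=1..Suc k. 2 ^ i + 1)"
    by (simp add: prod.nat_ivl_Suc')
  \<comment> \<open>The exponent \<open>2 * k\<^sup>2\<close> grows by \<open>4 * k + 2\<close> from
    \<open>k\<close> to \<open>Suc k\<close>, which leaves ample room for one new factor.\<close>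
  also have "\<dots> \<le> 2 ^ (4 * k + 2) * k ^ (2 * k\<^sup>2)"
  proof (intro mult_mono Suc.IH)
    have "(1::nat) \<le> 2 ^ k" by simp
    then have "(2::nat) ^ Suc (Suc k) + 1 \<le> 2 ^ (k + 3)" by (simp add: power_add)
    also have "\<dots> \<le> 2 ^ (4 * k + 2)" using Suc.hyps by (intro power_increasing) auto
    finally show "(2::nat) ^ Suc (Suc k) + 1 \<le> 2 ^ (4 * k + 2)" .
  qed auto
  also have "\<dots> \<le> Suc k ^ (4 * k + 2) * Suc k ^ (2 * k\<^sup>2)"
    using Suc.hyps by (intro mult_mono power_mono) auto
  also have "\<dots> = Suc k ^ (2 * (Suc k)\<^sup>2)"
    unfolding power_add[symmetric] by (intro arg_cong[of _ _ "(^) (Suc k)"]) (simp add: power2_eq_square)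
  finally show ?case .
qed

lemma flag_exponent_ge:
  assumes "2 \<le> k"
  shows "real k powr (- 2 * real k ^ 2) \<le> flag_exponent (Suc k)"
proof -
  let ?P = "\<Prod>i=1..Suc k. 2 ^ i + 1 :: nat"
  have "real k powr (- 2 * real k ^ 2) = 1 / real k powr (real (2 * k\<^sup>2))"
    by (simp add: powr_minus_divide)
  also have "\<dots> = 1 / real (k ^ (2 * k\<^sup>2))"
    using assms by (subst powr_realpow) auto
  also have "\<dots> \<le> 1 / real ?P"
  proof (rule divide_left_mono)
    show "real ?P \<le> real (k ^ (2 * k\<^sup>2))" using prod_pow2_le[OF assms] by (rule of_nat_mono)
    have "0 < ?P" by (intro prod_pos) auto
    then show "0 < real (k ^ (2 * k\<^sup>2)) * real ?P" using assms by (simp only: of_nat_0_less_iff zero_less_mult_iff) auto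
  qed simp
  also have "\<dots> = flag_exponent (Suc k)"
    unfolding flag_exponent_def of_nat_prod prod_dividef by (simp add: add.commute)
  finally show ?thesis .
qed

theorem theorem1p1:
  fixes k :: nat
  assumes "k \<ge> 2"
  shows "\<exists>lam::real. lam \<ge> real k powr (- 2 * real k ^ 2) \<and>
    (\<forall>(V :: nat set) S. k_complex k V S \<longrightarrow>
      (\<exists>n\<^sub>0::nat. \<forall>n\<ge>n\<^sub>0. \<forall>(W :: nat set) T.
        k_complex k W T \<longrightarrow> card W = n \<longrightarrow>
        real (card T) \<ge> real n powr (real k + 1 - lam) \<longrightarrow>
        contains_homeomorph T S))"
proof (intro exI[of _ "flag_exponent (Suc k)"] conjI allI impI)
  show "real k powr (- 2 * real k ^ 2) \<le> flag_exponent (Suc k)"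
    by (rule flag_exponent_ge[OF assms])
next
  fix V :: "nat set" and S
  assume S: "k_complex k V S"
  then have "finite V" by (simp add: k_complex_def)
  from dense_tuples_contain_flag_embedding[OF this, of "Suc k", where 'b = nat]
  obtain n1 where n1: "\<forall>n\<ge>n1. \<forall>(W::nat set) G. finite W \<longrightarrow> card W = n \<longrightarrow> G \<subseteq> tuples (Suc k) W \<longrightarrow>
      real n powr (real (Suc k) - flag_exponent (Suc k)) \<le> card G \<longrightarrow>
      (\<exists>\<phi>. flag_embedding (Suc k) V W G \<phi>)"
    unfolding eventually_sequentially by (rule exE)
  have "contains_homeomorph T S"
    \<comment> \<open>Taking \<open>n\<close> at least 1 makes the facet bound positive, so that
      \<open>T\<close> is nonempty.\<close>
    if n: "max 1 n1 \<le> n" and T: "k_complex k W T" "card W = n"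
      and Tbig: "real n powr (real k + 1 - flag_exponent (Suc k)) \<le> real (card T)"
    for n and W :: "nat set" and T
  proof -
    have W: "finite W" and T': "\<And>e. e \<in> T \<Longrightarrow> e \<subseteq> W \<and> card e = Suc k"
      using T(1) by (auto simp: k_complex_def)
    have "0 < real n powr (real k + 1 - flag_exponent (Suc k))" using n by simp
    then have "T \<noteq> {}" using Tbig by auto
    define G where "G = {xs\<in>tuples (Suc k) W. set xs \<in> T}"
    \<comment> \<open>One ordering per facet already gives \<open>G\<close> enough tuples.\<close>
    have "T \<subseteq> set ` G"
    proof
      fix e assume e: "e \<in> T"
      then obtain xs where "set xs = e" "distinct xs"
        using T' W finite_distinct_list finite_subset by metis
      then have "xs \<in> G" using T'[OF e] e by (auto simp: G_def tuples_def distinct_card[symmetric])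
      then show "e \<in> set ` G" using \<open>set xs = e\<close> by blast
    qed
    moreover have "finite G" using finite_tuples[OF W] by (simp add: G_def)
    ultimately have "card T \<le> card G" by (rule surj_card_le[rotated])
    then have "real n powr (real (Suc k) - flag_exponent (Suc k)) \<le> card G"
      using Tbig by (simp add: add.commute)
    then obtain \<phi> where "flag_embedding (Suc k) V W G \<phi>"
      using n1[rule_format, of n W G] n W T(2) by (auto simp: G_def)
    then have "flag_embedding (Suc k) V W {xs. set xs \<in> T} \<phi>"
      by (auto simp: flag_embedding_def G_def)
    then show ?thesis using S \<open>T \<noteq> {}\<close> by (intro flag_embedding_imp_contains_homeomorph)
  qed
  then show "\<exists>n\<^sub>0. \<forall>n\<ge>n\<^sub>0. \<forall>(W::nat set) T. k_complex k W T \<longrightarrow> card W = n \<longrightarrow>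
      real n powr (real k + 1 - flag_exponent (Suc k)) \<le> real (card T) \<longrightarrow> contains_homeomorph T S"
    by blast
qed

end
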